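(* There exist absolute constants $0<c<1$ and $C>0$ and a randomized algorithm such that, for any $\varepsilon\in(0,1]$ and any distribution $Q$ over $[\ell]$, given ${\sf PAIRCOND}$ access to $Q$, setting $\alpha=c\varepsilon$: if $Q\in\mathcal{P}_\alpha$ the algorithm returns ACCEPT with probability at least $2/3$, and if $d_{TV}(Q,\mathcal{P}_\alpha)\ge C\varepsilon$ the algorithm returns REJECT with probability at least $2/3$. The number of ${\sf PAIRCOND}$ queries performed is $\tilde{O}(1/\varepsilon^8)$.
   Context: $d_{TV}(D_1,D_2)=\frac12\sum_x|D_1(x)-D_2(x)|$, $d_{TV}(Q,\mathcal{P})=\inf_{Q'\in\mathcal{P}}d_{TV}(Q,Q')$. $\mathcal{P}_\alpha$ is the set of distributions $Q'$ over $[\ell]$ such that $Q'(k+1)\le(1+\alpha)Q'(k)$ for all $k<\ell$. A ${\sf PAIRCOND}$ oracle for $Q$ accepts as query either the whole domain $[\ell]$ or a two-element set $S=\{x,y\}$ with $Q(S)>0$, and returns $i\in S$ with probability $Q(i)/Q(S)$, independently of previous calls. $\tilde{O}(\cdot)$ hides polylogarithmic factors in its argument. *)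

theory Defs
  imports "HOL-Probability.Probability" "HOL-Library.Landau_Symbols"
begin

text \<open>
  The domain is \<open>{1..l}\<close>; a distribution over it is a \<open>nat pmf\<close> whose support is contained
  in \<open>{1..l}\<close> (so \<open>l \<ge> 1\<close> whenever there is one).
\<close>

definition dists :: "nat \<Rightarrow> nat pmf set" where
  "dists l = {Q. set_pmf Q \<subseteq> {1..l}}"

definition d_TV :: "nat \<Rightarrow> nat pmf \<Rightarrow> nat pmf \<Rightarrow> real" where
  "d_TV l D1 D2 = (1/2) * (\<Sum>x\<in>{1..l}. \<bar>pmf D1 x - pmf D2 x\<bar>)"

text \<open>
  The infimum is only used for nonempty \<open>P\<close>; on the empty set the real-valued \<open>Inf\<close> is
  unspecified.
\<close>

definition d_TV_set :: "nat \<Rightarrow> nat pmf \<Rightarrow> nat pmf set \<Rightarrow> real" where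
  "d_TV_set l Q P = (INF Q'\<in>P. d_TV l Q Q')"

definition approx_decreasing :: "nat \<Rightarrow> real \<Rightarrow> nat pmf set" where
  "approx_decreasing l \<alpha> =
     {Q' \<in> dists l. \<forall>k\<in>{1..<l}. pmf Q' (k + 1) \<le> (1 + \<alpha>) * pmf Q' k}"

text \<open>The uniform distribution witnesses that \<open>d_TV_set\<close> is a genuine infimum below.\<close>

lemma approx_decreasing_nonempty:
  assumes "l \<ge> 1" "\<alpha> \<ge> 0"
  shows "approx_decreasing l \<alpha> \<noteq> {}"
proof -
  have "pmf_of_set {1..l} \<in> approx_decreasing l \<alpha>"
    using assms by (auto simp: approx_decreasing_def dists_def field_simps)
  then show ?thesis by blast
qed

text \<open>
  A randomized algorithm with oracle access is an adaptive strategy: \<open>Random p f\<close> draws \<open>r\<close>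
  from its internal randomness \<open>p\<close> and continues with \<open>f r\<close>; \<open>Query S f\<close> queries the oracle
  on \<open>S\<close> and continues with \<open>f i\<close> on answer \<open>i\<close>. The strategy does not mention the unknown
  distribution \<open>Q\<close>, which enters only through the oracle's answers.
\<close>

datatype verdict = ACCEPT | REJECT

datatype algorithm =
    Return verdict
  | Random "nat pmf" "nat \<Rightarrow> algorithm"
  | Query "nat set" "nat \<Rightarrow> algorithm"

definition paircond_query :: "nat \<Rightarrow> nat pmf \<Rightarrow> nat set \<Rightarrow> bool" where
  "paircond_query l Q S \<longleftrightarrow>
     S = {1..l} \<or>
     (\<exists>x\<in>{1..l}. \<exists>y\<in>{1..l}. x \<noteq> y \<and> S = {x, y} \<and> measure_pmf.prob Q S > 0)"

text \<open>
  The joint distribution of the verdict and the number of oracle queries made. On an accepted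
  query \<open>S\<close>, \<open>cond_pmf Q S\<close> gives each \<open>i \<in> S\<close> probability \<open>Q(i)/Q(S)\<close>; it is unspecified
  when \<open>Q(S) = 0\<close>, which \<open>only_paircond\<close> excludes.
\<close>

primrec run :: "nat pmf \<Rightarrow> algorithm \<Rightarrow> (verdict \<times> nat) pmf" where
  "run Q (Return v) = return_pmf (v, 0)"
| "run Q (Random p f) = bind_pmf p (\<lambda>r. run Q (f r))"
| "run Q (Query S f) =
     bind_pmf (cond_pmf Q S) (\<lambda>i. map_pmf (\<lambda>(v, n). (v, Suc n)) (run Q (f i)))"

text \<open>Every query made with positive probability is one that the oracle for \<open>Q\<close> accepts.\<close>

primrec only_paircond :: "nat \<Rightarrow> nat pmf \<Rightarrow> algorithm \<Rightarrow> bool" where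
  "only_paircond l Q (Return v) \<longleftrightarrow> True"
| "only_paircond l Q (Random p f) \<longleftrightarrow> (\<forall>r\<in>set_pmf p. only_paircond l Q (f r))"
| "only_paircond l Q (Query S f) \<longleftrightarrow>
     paircond_query l Q S \<and> (\<forall>i\<in>set_pmf (cond_pmf Q S). only_paircond l Q (f i))"

definition prob_returns :: "nat pmf \<Rightarrow> algorithm \<Rightarrow> verdict \<Rightarrow> real" where
  "prob_returns Q A v = pmf (map_pmf fst (run Q A)) v"

text \<open>
  Soft-O: \<open>O(g polylog g)\<close>. The shift by 2 keeps the logarithm bounded away from 0 where
  \<open>g\<close> is close to 1, so that the filter may also be a principal one (a uniform bound on a set).
\<close>

definition soft_bigo :: "'a filter \<Rightarrow> ('a \<Rightarrow> real) \<Rightarrow> ('a \<Rightarrow> real) set" where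
  "soft_bigo F g = (\<Union>k::nat. O[F](\<lambda>x. g x * ln (2 + g x) ^ k))"

end

theory Submission
  imports Defs
begin

text \<open>
  Only adjacent pairs need to be compared. Write \<open>e k = max 0 (Q k - (1 + \<alpha>) * Q (k - 1))\<close>. Adding
  to \<open>Q\<close>, to the left of every \<open>k\<close>, the geometric tail \<open>e k / (1 + \<alpha>) ^ i\<close> at \<open>k - i\<close> repairs all
  violations at a total cost of at most \<open>(\<Sum>k. e k) / \<alpha>\<close>. If \<open>Q\<close> is \<open>4 * \<epsilon>\<close>-far and
  \<open>\<alpha> = \<epsilon> / 2\<close>, then \<open>\<Sum>k. e k \<ge> 2 * \<epsilon>\<^sup>2\<close>, so that a point drawn from \<open>Q\<close> satisfies
  \<open>e k \<ge> \<epsilon>\<^sup>2 * Q k\<close> with probability at least \<open>\<epsilon>\<^sup>2\<close>. Hence \<open>O(1/\<epsilon>\<^sup>2)\<close> draws suffice, each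
  followed by an estimate of \<open>Q k / (Q (k - 1) + Q k)\<close> up to \<open>O(\<epsilon>\<^sup>2)\<close> with failure probability
  \<open>O(\<epsilon>\<^sup>2)\<close>, for which \<open>O(1/\<epsilon>\<^sup>6)\<close> pair queries are enough.
\<close>

subsection \<open>Distance to the approximately decreasing distributions\<close>

text \<open>Sums of it start at 2: the predecessor of 1 is 0, outside the domain, so at 1 it would
  charge the full mass.\<close>

definition growth_excess :: "nat pmf \<Rightarrow> real \<Rightarrow> nat \<Rightarrow> real" where
  "growth_excess Q \<alpha> k = max 0 (pmf Q k - (1 + \<alpha>) * pmf Q (k - 1))"

lemma growth_excess_nonneg [simp]: "growth_excess Q \<alpha> k \<ge> 0"
  by (simp add: growth_excess_def)

lemma growth_excess_le_pmf: "\<alpha> \<ge> 0 \<Longrightarrow> growth_excess Q \<alpha> k \<le> pmf Q k"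
  by (simp add: growth_excess_def)

lemma sum_pmf_dists: "Q \<in> dists l \<Longrightarrow> (\<Sum>x\<in>{1..l}. pmf Q x) = 1"
  by (rule sum_pmf_eq_1) (auto simp: dists_def)

lemma d_TV_set_le:
  assumes "Q' \<in> P"
  shows "d_TV_set l Q P \<le> d_TV l Q Q'"
proof -
  have "bdd_below (d_TV l Q ` P)"
    by (rule bdd_belowI2[of _ 0]) (simp add: d_TV_def sum_nonneg)
  then show ?thesis
    using assms unfolding d_TV_set_def by (rule cINF_lower)
qed

lemma sum_inverse_powers_le:
  fixes \<alpha> :: real
  assumes "\<alpha> > 0"
  shows "(\<Sum>x\<in>{1..<y}. 1 / (1 + \<alpha>) ^ (y - x)) \<le> 1 / \<alpha>"
proof -
  have "(\<Sum>x\<in>{1..<y}. 1 / (1 + \<alpha>) ^ (y - x)) = (\<Sum>i\<in>{1..<y}. 1 / (1 + \<alpha>) ^ i)"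
    by (rule sum.reindex_bij_witness[of _ "\<lambda>i. y - i" "\<lambda>i. y - i"]) auto
  \<comment> \<open>The induction needs the closed form of the partial sums; truncated subtraction
    makes both sides 0 at \<open>y = 0\<close>.\<close>
  also have "\<dots> \<le> 1 / \<alpha> * (1 - 1 / (1 + \<alpha>) ^ (y - 1))"
  proof (induction y)
    case (Suc n)
    show ?case
    proof (cases n)
      case (Suc k)
      have "1 / \<alpha> * (1 - 1 / (1 + \<alpha>) ^ k) + 1 / (1 + \<alpha>) ^ Suc k = 1 / \<alpha> * (1 - 1 / (1 + \<alpha>) ^ Suc k)"
      proof -
        define u where "u = (1 + \<alpha>) ^ k"
        have "u > 0" "1 + \<alpha> \<noteq> 0"
          using assms by (simp_all add: u_def)
        then have "1 / \<alpha> * (1 - 1 / u) + 1 / ((1 + \<alpha>) * u) = 1 / \<alpha> * (1 - 1 / ((1 + \<alpha>) * u))"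
          using assms by (simp add: divide_simps) (simp add: algebra_simps)
        then show ?thesis
          by (simp add: u_def)
      qed
      then show ?thesis
        using Suc.IH Suc by simp
    qed simp
  qed simp
  also have "\<dots> \<le> 1 / \<alpha>"
    using assms by (simp add: divide_right_mono)
  finally show ?thesis .
qed

text \<open>Pointwise, \<open>Q - Q'\<close> equals \<open>w * Q' - W\<close>, and each of these two
  nonnegative terms sums to \<open>w\<close>. So the absolute differences sum to at most
  \<open>2 * w\<close>, which the factor 1/2 halves.\<close>

lemma d_TV_normalize_le:
  assumes Q: "Q \<in> dists l" and W: "\<And>x. W x \<ge> 0"
    and Q': "\<And>x. x \<in> {1..l} \<Longrightarrow> pmf Q' x = (pmf Q x + W x) / (1 + (\<Sum>x\<in>{1..l}. W x))"
  shows "d_TV l Q Q' \<le> (\<Sum>x\<in>{1..l}. W x)"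
proof -
  define w where "w = (\<Sum>x\<in>{1..l}. W x)"
  have w: "w \<ge> 0"
    unfolding w_def using W by (simp add: sum_nonneg)
  have "\<bar>pmf Q x - pmf Q' x\<bar> \<le> W x + w * ((pmf Q x + W x) / (1 + w))" if "x \<in> {1..l}" for x
  proof -
    have "pmf Q x - pmf Q' x = w * ((pmf Q x + W x) / (1 + w)) - W x"
      using w unfolding Q'[OF that, folded w_def] by (simp add: field_simps)
    moreover have "w * ((pmf Q x + W x) / (1 + w)) \<ge> 0"
      using w W by simp
    ultimately show ?thesis
      using W[of x] by (simp add: abs_le_iff)
  qed
  then have "(\<Sum>x\<in>{1..l}. \<bar>pmf Q x - pmf Q' x\<bar>)
      \<le> (\<Sum>x\<in>{1..l}. W x + w * ((pmf Q x + W x) / (1 + w)))"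
    by (rule sum_mono)
  also have "\<dots> = w + w * (((\<Sum>x\<in>{1..l}. pmf Q x) + w) / (1 + w))"
    by (simp add: sum.distrib w_def flip: sum_distrib_left sum_divide_distrib)
  also have "\<dots> = 2 * w"
    unfolding sum_pmf_dists[OF Q] using w by simp
  finally show ?thesis
    by (simp add: d_TV_def w_def)
qed

text \<open>Turns the distance hypothesis into a lower bound on the total excess, which adjacent
  comparisons can detect.\<close>

lemma d_TV_set_approx_decreasing_le:
  assumes Q: "Q \<in> dists l" and \<alpha>: "\<alpha> > 0"
  shows "d_TV_set l Q (approx_decreasing l \<alpha>) \<le> (\<Sum>k\<in>{2..l}. growth_excess Q \<alpha> k) / \<alpha>"
proof -
  define e where "e = growth_excess Q \<alpha>"
  have e: "e k \<ge> 0" for k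
    by (simp add: e_def)
  \<comment> \<open>\<open>W x\<close> collects the tails sent to \<open>x\<close> by all points to
    its right; dividing by \<open>1 + w\<close> later restores total mass 1.\<close>
  define W where "W x = (\<Sum>y\<in>{x<..l}. e y / (1 + \<alpha>) ^ (y - x))" for x
  have W: "W x \<ge> 0" for x
    unfolding W_def using e \<alpha> by (simp add: sum_nonneg)
  define w where "w = (\<Sum>x\<in>{1..l}. W x)"
  have w: "w \<ge> 0"
    unfolding w_def using W by (simp add: sum_nonneg)
  define g where "g x = (if x \<in> {1..l} then (pmf Q x + W x) / (1 + w) else 0)" for x
  have g: "g x \<ge> 0" for x
    using W w by (simp add: g_def)
  have sum_g: "(\<Sum>x\<in>{1..l}. g x) = 1"
    using w sum_pmf_dists[OF Q]
    by (simp add: g_def sum.distrib w_def[symmetric] sum_divide_distrib[symmetric] del: One_nat_def)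
  have "(\<integral>\<^sup>+ x. ennreal (g x) \<partial>count_space UNIV) = (\<Sum>x\<in>{1..l}. ennreal (g x))"
    by (rule nn_integral_count_space'[OF finite_atLeastAtMost]) (auto simp: g_def)
  also have "\<dots> = 1"
    using g sum_g by (simp add: sum_ennreal)
  finally have nn: "(\<integral>\<^sup>+ x. ennreal (g x) \<partial>count_space UNIV) = 1" .
  define Q' where "Q' = embed_pmf g"
  have pmf_Q': "pmf Q' x = g x" for x
    unfolding Q'_def using g nn by (rule pmf_embed_pmf)
  \<comment> \<open>One step to the right multiplies every surviving tail by
    \<open>1 + \<alpha>\<close> and drops the tail of \<open>k + 1\<close>, which had
    \<open>e (k + 1) / (1 + \<alpha>)\<close> at \<open>k\<close>.\<close>
  have W_rec: "(1 + \<alpha>) * W k = W (k + 1) + e (k + 1)" if "k < l" for k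
  proof -
    have "{k<..l} = insert (k + 1) {k + 1<..l}"
      using that by auto
    then have "(1 + \<alpha>) * W k = (1 + \<alpha>) * (e (k + 1) / (1 + \<alpha>) +
        (\<Sum>y\<in>{k + 1<..l}. e y / (1 + \<alpha>) ^ (y - k)))"
      by (simp add: W_def)
    also have "\<dots> = e (k + 1) + (\<Sum>y\<in>{k + 1<..l}. (1 + \<alpha>) * (e y / (1 + \<alpha>) ^ (y - k)))"
      using \<alpha> by (simp add: distrib_left sum_distrib_left)
    also have "(\<Sum>y\<in>{k + 1<..l}. (1 + \<alpha>) * (e y / (1 + \<alpha>) ^ (y - k))) = W (k + 1)"
      unfolding W_def
    proof (rule sum.cong)
      fix y assume "y \<in> {k + 1<..l}"
      then have "y - k = Suc (y - (k + 1))"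
        by auto
      then show "(1 + \<alpha>) * (e y / (1 + \<alpha>) ^ (y - k)) = e y / (1 + \<alpha>) ^ (y - (k + 1))"
        using \<alpha> by simp
    qed simp
    finally show ?thesis
      by simp
  qed
  have "Q' \<in> approx_decreasing l \<alpha>"
    unfolding approx_decreasing_def
  proof (intro CollectI conjI ballI)
    show "Q' \<in> dists l"
      by (auto simp: dists_def set_pmf_iff pmf_Q' g_def split: if_splits)
    fix k assume k: "k \<in> {1..<l}"
    \<comment> \<open>The slack \<open>(1 + \<alpha>) * W k - W (k + 1)\<close> is exactly the
      excess at \<open>k + 1\<close>.\<close>
    have "pmf Q (k + 1) + W (k + 1) \<le> (1 + \<alpha>) * (pmf Q k + W k)"
      using W_rec[of k] k by (simp add: distrib_left e_def growth_excess_def)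
    then have "(pmf Q (k + 1) + W (k + 1)) / (1 + w) \<le> (1 + \<alpha>) * (pmf Q k + W k) / (1 + w)"
      using w by (intro divide_right_mono) auto
    then show "pmf Q' (k + 1) \<le> (1 + \<alpha>) * pmf Q' k"
      using k by (simp add: pmf_Q' g_def)
  qed
  then have "d_TV_set l Q (approx_decreasing l \<alpha>) \<le> d_TV l Q Q'"
    by (rule d_TV_set_le)
  also have "\<dots> \<le> w"
    unfolding w_def by (rule d_TV_normalize_le[OF Q W]) (simp add: pmf_Q' g_def w_def)
  \<comment> \<open>Prepares the exchange of sums, which charges each tail to the point sending
    it.\<close>
  also have "w = (\<Sum>x\<in>{1..l}. \<Sum>y | y \<in> {2..l} \<and> x < y. e y / (1 + \<alpha>) ^ (y - x))"
    unfolding w_def W_def by (intro sum.cong) auto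
  also have "\<dots> = (\<Sum>y\<in>{2..l}. \<Sum>x | x \<in> {1..l} \<and> x < y. e y / (1 + \<alpha>) ^ (y - x))"
    by (rule sum.swap_restrict) auto
  also have "\<dots> = (\<Sum>y\<in>{2..l}. e y * (\<Sum>x\<in>{1..<y}. 1 / (1 + \<alpha>) ^ (y - x)))"
    unfolding sum_distrib_left by (intro sum.cong) auto
  also have "\<dots> \<le> (\<Sum>y\<in>{2..l}. e y * (1 / \<alpha>))"
    using sum_inverse_powers_le[OF \<alpha>] e by (intro sum_mono mult_left_mono) auto
  also have "\<dots> = (\<Sum>y\<in>{2..l}. e y) / \<alpha>"
    by (simp add: sum_divide_distrib)
  finally show ?thesis
    by (simp add: e_def)
qed

subsection \<open>The tester\<close>

text \<open>The datatype has no sequencing constructor, so \<open>k\<close> accumulates the count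
  and the rest of the algorithm is the continuation \<open>f\<close>.\<close>

primrec count_answers :: "nat set \<Rightarrow> nat \<Rightarrow> nat \<Rightarrow> nat \<Rightarrow> (nat \<Rightarrow> algorithm) \<Rightarrow> algorithm" where
  "count_answers S x 0 k f = f k"
| "count_answers S x (Suc R) k f =
     Query S (\<lambda>i. count_answers S x R (of_bool (i = x) + k) f)"

text \<open>A drawn point has positive probability, hence so has the pair queried with it. The point
  1 has no left neighbour, so its round passes.\<close>

primrec adjacent_tester :: "nat \<Rightarrow> nat \<Rightarrow> real \<Rightarrow> nat \<Rightarrow> algorithm" where
  "adjacent_tester l R \<tau> 0 = Return ACCEPT"
| "adjacent_tester l R \<tau> (Suc m) = Query {1..l} (\<lambda>x.
     if x \<le> 1 then adjacent_tester l R \<tau> m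
     else count_answers {x - 1, x} x R 0 (\<lambda>k.
       if \<tau> \<le> real k / real R then Return REJECT else adjacent_tester l R \<tau> m))"

section \<open>The law of the verdict\<close>

definition verdict_pmf :: "nat pmf \<Rightarrow> algorithm \<Rightarrow> verdict pmf" where
  "verdict_pmf Q A = map_pmf fst (run Q A)"

lemma verdict_pmf_simps [simp]:
  "verdict_pmf Q (Return v) = return_pmf v"
  "verdict_pmf Q (Query S f) = bind_pmf (cond_pmf Q S) (\<lambda>i. verdict_pmf Q (f i))"
  by (simp_all add: verdict_pmf_def map_bind_pmf map_pmf_comp case_prod_unfold)

lemma pmf_ratio_bounds: "pmf Q x / (pmf Q x + pmf Q y) \<in> {0..1}"
  using pmf_nonneg[of Q x] pmf_nonneg[of Q y] by (simp add: divide_le_eq_1 del: pmf_nonneg) linarith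

text \<open>Reduces oracle answers to coin tosses, so that counts become binomial. A law on booleans
  is determined by its value at \<open>True\<close>.\<close>

lemma map_cond_pmf_pair:
  assumes "x \<noteq> y" and "x \<in> set_pmf Q"
  shows "map_pmf (\<lambda>i. i = x) (cond_pmf Q {y, x}) =
    bernoulli_pmf (pmf Q x / (pmf Q x + pmf Q y))"
proof -
  have ne: "set_pmf Q \<inter> {y, x} \<noteq> {}"
    using assms by auto
  have "pmf (map_pmf (\<lambda>i. i = x) (cond_pmf Q {y, x})) True = pmf (cond_pmf Q {y, x}) x"
    by (simp add: pmf_map vimage_def flip: pmf.rep_eq)
      (simp add: measure_pmf_single)
  also have "\<dots> = pmf Q x / (pmf Q x + pmf Q y)"
    using assms by (simp add: pmf_cond[OF ne] measure_measure_pmf_finite add.commute)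
  finally have "pmf (map_pmf (\<lambda>i. i = x) (cond_pmf Q {y, x})) True =
      pmf (bernoulli_pmf (pmf Q x / (pmf Q x + pmf Q y))) True"
    using pmf_ratio_bounds[of Q x y] by simp
  then show ?thesis
    by (intro pmf_eqI) (metis (full_types) pmf_False_conv_True)
qed

text \<open>Each query adds one Bernoulli trial to the accumulator; hence the induction is over
  arbitrary \<open>k\<close>.\<close>

lemma verdict_pmf_count_answers:
  assumes "x \<noteq> y" and "x \<in> set_pmf Q"
  shows "verdict_pmf Q (count_answers {y, x} x R k f) =
    bind_pmf (binomial_pmf R (pmf Q x / (pmf Q x + pmf Q y))) (\<lambda>j. verdict_pmf Q (f (j + k)))"
proof (induction R arbitrary: k)
  case 0
  then show ?case
    using pmf_ratio_bounds[of Q x y] by (simp add: binomial_pmf_0 bind_return_pmf)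
next
  case (Suc R)
  let ?p = "pmf Q x / (pmf Q x + pmf Q y)"
  have "verdict_pmf Q (count_answers {y, x} x (Suc R) k f) =
      bind_pmf (map_pmf (\<lambda>i. i = x) (cond_pmf Q {y, x})) (\<lambda>b.
        bind_pmf (binomial_pmf R ?p) (\<lambda>j. verdict_pmf Q (f (j + (of_bool b + k)))))"
    by (simp add: Suc.IH bind_map_pmf)
  also have "\<dots> = bind_pmf (binomial_pmf (Suc R) ?p) (\<lambda>j. verdict_pmf Q (f (j + k)))"
    by (subst map_cond_pmf_pair[OF assms], subst binomial_pmf_Suc[OF pmf_ratio_bounds])
      (auto simp: bind_assoc_pmf bind_return_pmf ac_simps of_bool_def intro!: bind_pmf_cong)
  finally show ?case .
qed

text \<open>Abstracts a round to one boolean, given its drawn point, so that the tester becomes a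
  sequence of independent trials.\<close>

definition round_rejects :: "nat pmf \<Rightarrow> nat \<Rightarrow> real \<Rightarrow> nat \<Rightarrow> bool pmf" where
  "round_rejects Q R \<tau> x = (if x \<le> 1 then return_pmf False
     else map_pmf (\<lambda>k. \<tau> \<le> real k / real R)
       (binomial_pmf R (pmf Q x / (pmf Q x + pmf Q (x - 1)))))"

lemma cond_pmf_dists:
  assumes "Q \<in> dists l"
  shows "cond_pmf Q {1..l} = Q"
proof (rule pmf_eqI)
  fix x
  have sub: "set_pmf Q \<subseteq> {1..l}" and ne: "set_pmf Q \<inter> {1..l} \<noteq> {}"
    using assms set_pmf_not_empty[of Q] by (auto simp: dists_def)
  have "measure_pmf.prob Q {1..l} = 1"
    using sub by (simp add: measure_pmf.prob_eq_1 AE_measure_pmf_iff subset_iff)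
  then show "pmf (cond_pmf Q {1..l}) x = pmf Q x"
    using sub by (auto simp: pmf_cond[OF ne] pmf_eq_0_set_pmf simp del: One_nat_def)
qed

text \<open>Acceptance means that all \<open>m\<close> rounds pass, and a passing round hands no
  information to the next.\<close>

lemma pmf_verdict_adjacent_tester:
  assumes Q: "Q \<in> dists l"
  shows "pmf (verdict_pmf Q (adjacent_tester l R \<tau> m)) ACCEPT =
    (1 - pmf (bind_pmf Q (round_rejects Q R \<tau>)) True) ^ m"
proof (induction m)
  case (Suc m)
  let ?A = "adjacent_tester l R \<tau>" and ?B = "bind_pmf Q (round_rejects Q R \<tau>)"
  have "verdict_pmf Q (?A (Suc m)) = bind_pmf ?B
      (\<lambda>b. if b then return_pmf REJECT else verdict_pmf Q (?A m))"
    unfolding adjacent_tester.simps verdict_pmf_simps cond_pmf_dists[OF Q] bind_assoc_pmf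
  proof (rule bind_pmf_cong[OF refl])
    fix x assume x: "x \<in> set_pmf Q"
    show "verdict_pmf Q (if x \<le> 1 then ?A m else count_answers {x - 1, x} x R 0
          (\<lambda>k. if \<tau> \<le> real k / real R then Return REJECT else ?A m)) =
        bind_pmf (round_rejects Q R \<tau> x) (\<lambda>b. if b then return_pmf REJECT else verdict_pmf Q (?A m))"
    proof (cases "x \<le> 1")
      case False
      then show ?thesis
        using x by (subst if_not_P, simp, subst verdict_pmf_count_answers)
          (auto simp: round_rejects_def bind_map_pmf intro!: bind_pmf_cong)
    qed (simp add: round_rejects_def bind_return_pmf)
  qed
  then have "pmf (verdict_pmf Q (?A (Suc m))) ACCEPT =
      measure_pmf.expectation ?B
        (\<lambda>b. pmf (if b then return_pmf REJECT else verdict_pmf Q (?A m)) ACCEPT)"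
    by (simp add: pmf_bind)
  \<comment> \<open>The outcome \<open>True\<close> forces REJECT and contributes 0.\<close>
  also have "\<dots> = pmf ?B False * pmf (verdict_pmf Q (?A m)) ACCEPT"
    by (subst integral_measure_pmf_real[of UNIV]) (auto simp: UNIV_bool)
  finally show ?case
    by (simp add: Suc.IH pmf_False_conv_True)
qed simp

lemma prob_returns_REJECT: "prob_returns Q A REJECT = 1 - prob_returns Q A ACCEPT"
proof -
  have "v \<in> {ACCEPT, REJECT}" for v
    by (cases v) auto
  then have "(\<Sum>v\<in>{ACCEPT, REJECT}. prob_returns Q A v) = 1"
    unfolding prob_returns_def by (intro sum_pmf_eq_1) (blast intro: finite.intros)+
  then show ?thesis
    by simp
qed

section \<open>Legality and number of the queries\<close>

lemma only_paircond_count_answers: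
  assumes "paircond_query l Q S" and "\<And>k. only_paircond l Q (f k)"
  shows "only_paircond l Q (count_answers S x R k f)"
  using assms by (induction R arbitrary: k) auto

lemma only_paircond_adjacent_tester:
  assumes Q: "Q \<in> dists l"
  shows "only_paircond l Q (adjacent_tester l R \<tau> m)"
proof (induction m)
  case (Suc m)
  have "paircond_query l Q {x - 1, x}" if "x \<in> set_pmf Q" "\<not> x \<le> 1" for x
    unfolding paircond_query_def
  proof (intro disjI2 bexI conjI)
    show "x \<in> {1..l}" "x - 1 \<in> {1..l}" "x - 1 \<noteq> x"
      using that Q by (auto simp: dists_def)
    show "measure_pmf.prob Q {x - 1, x} > 0"
      using that by (intro measure_pmf_posI[of x]) auto
  qed simp
  then show ?case
    using Suc.IH cond_pmf_dists[OF Q]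
    by (auto simp: paircond_query_def intro!: only_paircond_count_answers)
qed simp

lemma queries_count_answers:
  assumes "\<And>k v n. (v, n) \<in> set_pmf (run Q (f k)) \<Longrightarrow> n \<le> N"
    and "(v, n) \<in> set_pmf (run Q (count_answers S x R k f))"
  shows "n \<le> R + N"
  using assms(2)
proof (induction R arbitrary: k v n)
  case 0
  then show ?case
    using assms(1) by auto
next
  case (Suc R)
  then show ?case
    by (fastforce simp: case_prod_unfold)
qed

lemma queries_adjacent_tester:
  "(v, n) \<in> set_pmf (run Q (adjacent_tester l R \<tau> m)) \<Longrightarrow> n \<le> m * (R + 1)"
proof (induction m arbitrary: v n)
  case (Suc m)
  then obtain x n' where n: "n = Suc n'" and mem: "(v, n') \<in> set_pmf (run Q
      (if x \<le> 1 then adjacent_tester l R \<tau> m else count_answers {x - 1, x} x R 0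
        (\<lambda>k. if \<tau> \<le> real k / real R then Return REJECT else adjacent_tester l R \<tau> m)))"
    by (fastforce simp: case_prod_unfold simp del: count_answers.simps)
  have "n' \<le> R + m * (R + 1)"
  proof (cases "x \<le> 1")
    case True
    then show ?thesis
      using mem Suc.IH by fastforce
  next
    case False
    show ?thesis
    proof (rule queries_count_answers)
      show "(v, n') \<in> set_pmf (run Q (count_answers {x - 1, x} x R 0
          (\<lambda>k. if \<tau> \<le> real k / real R then Return REJECT else adjacent_tester l R \<tau> m)))"
        using mem False by simp
    qed (use Suc.IH in \<open>auto split: if_splits\<close>)
  qed
  then show ?case
    by (simp add: n)
qed simp

subsection \<open>One round of the tester\<close>

lemma pmf_round_rejects:
  "pmf (round_rejects Q R \<tau> x) True = (if x \<le> 1 then 0 else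
     measure_pmf.prob (binomial_pmf R (pmf Q x / (pmf Q x + pmf Q (x - 1)))) {k. \<tau> \<le> real k / real R})"
  by (simp add: round_rejects_def pmf_map vimage_def)

text \<open>Weakens Hoeffding's exponential to a polynomial bound, which the query budget can
  afford.\<close>

lemma exp_minus_le_inverse: "(x::real) > 0 \<Longrightarrow> exp (- x) \<le> 1 / x"
proof -
  assume "x > 0"
  moreover have "x \<le> exp x"
    using exp_ge_add_one_self[of x] by linarith
  ultimately show ?thesis
    by (simp add: exp_minus field_simps)
qed

text \<open>The success probability is at most \<open>(1 + \<alpha>) / (2 + \<alpha>)\<close>, its
  value at growth exactly \<open>1 + \<alpha>\<close>. The threshold lies \<open>t\<close> above, so
  Hoeffding's upper tail applies.\<close>

lemma round_rejects_le:
  assumes "pmf Q x \<le> (1 + \<alpha>) * pmf Q (x - 1)" and x: "x \<in> set_pmf Q"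
    and "\<alpha> \<ge> 0" "t > 0" "R > 0"
  shows "pmf (round_rejects Q R ((1 + \<alpha>) / (2 + \<alpha>) + t) x) True \<le> 1 / (2 * real R * t\<^sup>2)"
proof (cases "x \<le> 1")
  case False
  define p where "p = pmf Q x / (pmf Q x + pmf Q (x - 1))"
  have pos: "pmf Q x > 0" "pmf Q x + pmf Q (x - 1) > 0"
    using x by (simp_all add: pmf_positive add_pos_nonneg)
  interpret binomial_distribution R p
    using pmf_ratio_bounds[of Q x "x - 1"] \<open>R > 0\<close> by unfold_locales (simp_all add: p_def)
  have "p \<le> (1 + \<alpha>) / (2 + \<alpha>)"
    using assms(1) pos \<open>\<alpha> \<ge> 0\<close> by (simp add: p_def field_simps)
  then have "measure_pmf.prob (binomial_pmf R p) {k. (1 + \<alpha>) / (2 + \<alpha>) + t \<le> real k / real R}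
      \<le> measure_pmf.prob (binomial_pmf R p) {k. real k / real R \<ge> p + t}"
    by (intro measure_pmf.finite_measure_mono) auto
  also have "\<dots> \<le> exp (- 2 * real R * t\<^sup>2)"
    using prob_ge'[of t] \<open>t > 0\<close> \<open>R > 0\<close> by simp
  also have "\<dots> \<le> 1 / (2 * real R * t\<^sup>2)"
    using exp_minus_le_inverse[of "2 * real R * t\<^sup>2"] \<open>t > 0\<close> \<open>R > 0\<close> by simp
  finally show ?thesis
    using False by (simp add: pmf_round_rejects p_def)
qed (simp add: pmf_round_rejects)

text \<open>A relative excess of \<open>\<theta>\<close> lifts the success probability at least
  \<open>\<theta> / 6\<close> above \<open>(1 + \<alpha>) / (2 + \<alpha>)\<close>. The threshold
  stays \<open>\<theta> / 12\<close> below it, so Hoeffding's lower tail applies.\<close>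

lemma round_rejects_ge:
  assumes excess: "growth_excess Q \<alpha> x \<ge> \<theta> * pmf Q x" and x: "x \<in> set_pmf Q" "x > 1"
    and \<alpha>: "0 \<le> \<alpha>" "\<alpha> \<le> 1" and "\<theta> > 0" "R > 0"
  shows "pmf (round_rejects Q R ((1 + \<alpha>) / (2 + \<alpha>) + \<theta> / 12) x) True
    \<ge> 1 - 1 / (2 * real R * (\<theta> / 12)\<^sup>2)"
proof -
  define t where "t = \<theta> / 12"
  have t: "t > 0"
    using \<open>\<theta> > 0\<close> by (simp add: t_def)
  define p where "p = pmf Q x / (pmf Q x + pmf Q (x - 1))"
  define p0 where "p0 = (1 + \<alpha>) / (2 + \<alpha>)"
  have pos: "pmf Q x > 0" "pmf Q x + pmf Q (x - 1) > 0"
    using x by (simp_all add: pmf_positive add_pos_nonneg)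
  interpret binomial_distribution R p
    using pmf_ratio_bounds[of Q x "x - 1"] \<open>R > 0\<close> by unfold_locales (simp_all add: p_def)
  \<comment> \<open>The excess is positive, so the maximum in \<open>growth_excess\<close> is the
    difference.\<close>
  have "(1 + \<alpha>) * pmf Q (x - 1) \<le> (1 - \<theta>) * pmf Q x"
  proof -
    have "\<theta> * pmf Q x > 0"
      using pos \<open>\<theta> > 0\<close> by simp
    then show ?thesis
      using excess by (simp add: growth_excess_def max_def algebra_simps split: if_splits)
  qed
  then have "(1 + \<alpha>) * pmf Q (x - 1) / (pmf Q x + pmf Q (x - 1))
      \<le> (1 - \<theta>) * pmf Q x / (pmf Q x + pmf Q (x - 1))"
    using pos by (intro divide_right_mono) auto
  moreover have "pmf Q (x - 1) / (pmf Q x + pmf Q (x - 1)) = 1 - p"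
    using pos by (simp add: p_def field_simps)
  ultimately have "(1 + \<alpha>) * (1 - p) \<le> (1 - \<theta>) * p"
    by (simp only: p_def times_divide_eq_right[symmetric])
  \<comment> \<open>The gain \<open>\<theta> * p\<close> still involves \<open>p\<close>. Dropping
    it first gives \<open>p \<ge> p0 \<ge> 1 / 2\<close>, so it is at least
    \<open>\<theta> / 2\<close>.\<close>
  then have p_lower: "(2 + \<alpha>) * p \<ge> 1 + \<alpha> + \<theta> * p"
    by (simp add: algebra_simps)
  then have "(2 + \<alpha>) * p \<ge> 1 + \<alpha>"
    using \<open>\<theta> > 0\<close> pos by (smt (verit) mult_nonneg_nonneg p_def divide_nonneg_pos)
  then have "p \<ge> p0"
    using \<alpha> by (simp add: p0_def field_simps)
  moreover have "p0 \<ge> 1 / 2"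
    using \<alpha> by (simp add: p0_def field_simps)
  ultimately have "\<theta> * p \<ge> \<theta> / 2"
    using \<open>\<theta> > 0\<close> by simp
  \<comment> \<open>Dividing the gain by \<open>2 + \<alpha>\<close>, at most 3, leaves
    \<open>\<theta> / 6 = 2 * t\<close>.\<close>
  have "p0 + 2 * t \<le> p"
  proof -
    have "(2 + \<alpha>) * (p0 + 2 * t) = 1 + \<alpha> + (2 + \<alpha>) * (\<theta> / 6)"
      using \<alpha> by (simp add: p0_def t_def field_simps)
    also have "(2 + \<alpha>) * (\<theta> / 6) \<le> 3 * (\<theta> / 6)"
      using \<alpha> \<open>\<theta> > 0\<close> by (intro mult_right_mono) auto
    also have "1 + \<alpha> + 3 * (\<theta> / 6) \<le> (2 + \<alpha>) * p"
      using p_lower \<open>\<theta> * p \<ge> \<theta> / 2\<close> by simp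
    finally show ?thesis
      using \<alpha> by simp
  qed
  then have "measure_pmf.prob (binomial_pmf R p) (- {k. p0 + t \<le> real k / real R})
      \<le> measure_pmf.prob (binomial_pmf R p) {k. real k / real R \<le> p - t}"
    by (intro measure_pmf.finite_measure_mono) auto
  also have "\<dots> \<le> exp (- 2 * real R * t\<^sup>2)"
    using prob_le'[of t] t \<open>R > 0\<close> by simp
  also have "\<dots> \<le> 1 / (2 * real R * t\<^sup>2)"
    using exp_minus_le_inverse[of "2 * real R * t\<^sup>2"] t \<open>R > 0\<close> by simp
  finally have "1 - 1 / (2 * real R * t\<^sup>2) \<le>
      measure_pmf.prob (binomial_pmf R p) {k. p0 + t \<le> real k / real R}"
    using measure_pmf.prob_compl[of "{k. p0 + t \<le> real k / real R}" "binomial_pmf R p"]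
    by (simp add: Compl_eq_Diff_UNIV)
  then show ?thesis
    using \<open>x > 1\<close> by (simp add: pmf_round_rejects p_def p0_def t_def)
qed

section \<open>Rejection probability of a round at a random point\<close>

lemma pmf_bind_dists:
  assumes "Q \<in> dists l"
  shows "pmf (bind_pmf Q f) y = (\<Sum>x\<in>{1..l}. pmf (f x) y * pmf Q x)"
  unfolding pmf_bind by (rule integral_measure_pmf_real) (use assms in \<open>auto simp: dists_def\<close>)

lemma reject_prob_close:
  assumes Q: "Q \<in> approx_decreasing l \<alpha>" and "\<alpha> \<ge> 0" "t > 0" "R > 0"
  shows "pmf (bind_pmf Q (round_rejects Q R ((1 + \<alpha>) / (2 + \<alpha>) + t))) True \<le> 1 / (2 * real R * t\<^sup>2)"
proof -
  let ?\<tau> = "(1 + \<alpha>) / (2 + \<alpha>) + t" and ?err = "1 / (2 * real R * t\<^sup>2)"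
  have dists: "Q \<in> dists l"
    using Q by (simp add: approx_decreasing_def)
  have "pmf (round_rejects Q R ?\<tau> x) True * pmf Q x \<le> ?err * pmf Q x" if x: "x \<in> {1..l}" for x
  proof (cases "x \<in> set_pmf Q")
    case True
    have "pmf (round_rejects Q R ?\<tau> x) True \<le> ?err"
    proof (cases "x = 1")
      case False
      then have "x - 1 \<in> {1..<l}"
        using x by auto
      then have "pmf Q (x - 1 + 1) \<le> (1 + \<alpha>) * pmf Q (x - 1)"
        using Q unfolding approx_decreasing_def by blast
      then show ?thesis
        using x assms True by (intro round_rejects_le) auto
    qed (simp add: pmf_round_rejects)
    then show ?thesis
      by (intro mult_right_mono) auto
  qed (simp add: set_pmf_iff)
  then have "pmf (bind_pmf Q (round_rejects Q R ?\<tau>)) True \<le> (\<Sum>x\<in>{1..l}. ?err * pmf Q x)"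
    unfolding pmf_bind_dists[OF dists] by (rule sum_mono)
  also have "\<dots> = ?err"
    by (simp only: sum_distrib_left[symmetric] sum_pmf_dists[OF dists])
  finally show ?thesis .
qed

text \<open>Where the excess is above \<open>\<theta> * pmf Q x\<close>, the round rejects with
  probability at least 1/2 and the excess is at most \<open>pmf Q x\<close>; elsewhere the left side
  of \<open>pointwise\<close> is nonpositive. Summing loses at most \<open>\<theta>\<close>, as the
  total mass is 1.\<close>

lemma reject_prob_far:
  assumes Q: "Q \<in> dists l" and \<alpha>: "0 \<le> \<alpha>" "\<alpha> \<le> 1" and "\<theta> > 0" "R > 0"
    and err: "1 / (2 * real R * (\<theta> / 12)\<^sup>2) \<le> 1 / 2"
  shows "pmf (bind_pmf Q (round_rejects Q R ((1 + \<alpha>) / (2 + \<alpha>) + \<theta> / 12))) True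
    \<ge> ((\<Sum>x\<in>{2..l}. growth_excess Q \<alpha> x) - \<theta>) / 2"
proof -
  let ?\<tau> = "(1 + \<alpha>) / (2 + \<alpha>) + \<theta> / 12"
  have pointwise: "(growth_excess Q \<alpha> x - \<theta> * pmf Q x) / 2 \<le>
      pmf (round_rejects Q R ?\<tau> x) True * pmf Q x" if x: "x \<in> {2..l}" for x
  proof (cases "growth_excess Q \<alpha> x > \<theta> * pmf Q x")
    case True
    have "pmf Q x \<noteq> 0"
      using True growth_excess_le_pmf[OF \<alpha>(1), of Q x] by auto
    then have "1 - 1 / (2 * real R * (\<theta> / 12)\<^sup>2) \<le> pmf (round_rejects Q R ?\<tau> x) True"
      using True x assms by (intro round_rejects_ge) (auto simp: set_pmf_iff)
    then have "1 / 2 \<le> pmf (round_rejects Q R ?\<tau> x) True"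
      using err by linarith
    then have "1 / 2 * pmf Q x \<le> pmf (round_rejects Q R ?\<tau> x) True * pmf Q x"
      by (intro mult_right_mono) auto
    moreover have "\<theta> * pmf Q x \<ge> 0"
      using \<open>\<theta> > 0\<close> by simp
    then have "(growth_excess Q \<alpha> x - \<theta> * pmf Q x) / 2 \<le> 1 / 2 * pmf Q x"
      using growth_excess_le_pmf[OF \<alpha>(1), of Q x] by simp
    ultimately show ?thesis
      by (rule order.trans[rotated])
  next
    case False
    then have "(growth_excess Q \<alpha> x - \<theta> * pmf Q x) / 2 \<le> 0"
      by simp
    also have "0 \<le> pmf (round_rejects Q R ?\<tau> x) True * pmf Q x"
      by simp
    finally show ?thesis .
  qed
  have "(\<Sum>x\<in>{2..l}. pmf Q x) \<le> (\<Sum>x\<in>{1..l}. pmf Q x)"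
    by (intro sum_mono2) auto
  then have "\<theta> * (\<Sum>x\<in>{2..l}. pmf Q x) \<le> \<theta>"
    using sum_pmf_dists[OF Q] \<open>\<theta> > 0\<close> by (simp add: mult_left_le)
  then have "((\<Sum>x\<in>{2..l}. growth_excess Q \<alpha> x) - \<theta>) / 2
      \<le> (\<Sum>x\<in>{2..l}. (growth_excess Q \<alpha> x - \<theta> * pmf Q x) / 2)"
    by (simp add: sum_subtractf flip: sum_divide_distrib sum_distrib_left)
  also have "\<dots> \<le> (\<Sum>x\<in>{2..l}. pmf (round_rejects Q R ?\<tau> x) True * pmf Q x)"
    using pointwise by (rule sum_mono)
  also have "\<dots> \<le> (\<Sum>x\<in>{1..l}. pmf (round_rejects Q R ?\<tau> x) True * pmf Q x)"
    by (intro sum_mono2) auto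
  finally show ?thesis
    by (simp add: pmf_bind_dists[OF Q])
qed

section \<open>Choice of the parameters\<close>

theorem theorem4p15:
  "\<exists>(c::real) (C::real) (A :: nat \<Rightarrow> real \<Rightarrow> algorithm) (q :: real \<Rightarrow> real).
     0 < c \<and> c < 1 \<and> 0 < C \<and>
     q \<in> soft_bigo (principal {0<..1}) (\<lambda>\<epsilon>. 1 / \<epsilon> ^ 8) \<and>
     (\<forall>\<epsilon>\<in>{0<..1}. \<forall>(l::nat). \<forall>Q\<in>dists l.
        only_paircond l Q (A l \<epsilon>) \<and>
        (Q \<in> approx_decreasing l (c * \<epsilon>) \<longrightarrow>
           prob_returns Q (A l \<epsilon>) ACCEPT \<ge> 2/3) \<and>
        (d_TV_set l Q (approx_decreasing l (c * \<epsilon>)) \<ge> C * \<epsilon> \<longrightarrow>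
           prob_returns Q (A l \<epsilon>) REJECT \<ge> 2/3) \<and>
        (\<forall>(v, n) \<in> set_pmf (run Q (A l \<epsilon>)). real n \<le> q \<epsilon>))"
proof -
  \<comment> \<open>At accuracy \<open>t = \<epsilon>^2 / 12\<close> the error
    \<open>1 / (2 * R * t^2)\<close> is \<open>72 / (R * \<epsilon>^4)\<close>, hence at most
    \<open>\<epsilon>^2 / 15\<close>.\<close>
  define R where "R \<epsilon> = nat \<lceil>1080 / \<epsilon> ^ 6\<rceil>" for \<epsilon> :: real
  \<comment> \<open>At most \<open>5 / \<epsilon>^2\<close> rounds keep the total error at 1/3; at
    least \<open>4 / \<epsilon>^2\<close> rounds, each rejecting with probability
    \<open>\<epsilon>^2 / 2\<close> or more, give \<open>m * r \<ge> 2\<close>.\<close>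
  define m where "m \<epsilon> = nat \<lceil>4 / \<epsilon>\<^sup>2\<rceil>" for \<epsilon> :: real
  define \<tau> where "\<tau> \<epsilon> = (1 + \<epsilon> / 2) / (2 + \<epsilon> / 2) + \<epsilon>\<^sup>2 / 12" for \<epsilon> :: real
  define A where "A l \<epsilon> = adjacent_tester l (R \<epsilon>) (\<tau> \<epsilon>) (m \<epsilon>)" for l \<epsilon>
  define q where "q \<epsilon> = 6000 * (1 / \<epsilon> ^ 8)" for \<epsilon> :: real
  \<comment> \<open>The exponent 0 of the logarithm gives the plain bound
    \<open>O(1/\<epsilon>^8)\<close>.\<close>
  have "q \<in> O[principal {0<..1}](\<lambda>\<epsilon>. 1 / \<epsilon> ^ 8 * ln (2 + 1 / \<epsilon> ^ 8) ^ 0)"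
    by (intro landau_o.bigI[of 6000]) (simp_all add: q_def eventually_principal)
  then have q: "q \<in> soft_bigo (principal {0<..1}) (\<lambda>\<epsilon>. 1 / \<epsilon> ^ 8)"
    unfolding soft_bigo_def by blast
  have main: "only_paircond l Q (A l \<epsilon>) \<and>
      (Q \<in> approx_decreasing l (1 / 2 * \<epsilon>) \<longrightarrow> prob_returns Q (A l \<epsilon>) ACCEPT \<ge> 2/3) \<and>
      (d_TV_set l Q (approx_decreasing l (1 / 2 * \<epsilon>)) \<ge> 4 * \<epsilon> \<longrightarrow>
         prob_returns Q (A l \<epsilon>) REJECT \<ge> 2/3) \<and>
      (\<forall>(v, n) \<in> set_pmf (run Q (A l \<epsilon>)). real n \<le> q \<epsilon>)"
    if \<epsilon>: "\<epsilon> \<in> {0<..1}" and Q: "Q \<in> dists l" for \<epsilon> l Q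
  proof -
    have \<epsilon>01: "\<epsilon> > 0" "\<epsilon> \<le> 1"
      using \<epsilon> by auto
    have eps_pow: "0 < \<epsilon> ^ k" "\<epsilon> ^ k \<le> 1" "1 \<le> 1 / \<epsilon> ^ k" for k
      using \<epsilon>01 by (simp_all add: power_le_one)
    \<comment> \<open>Rounding up and the drawing query each add at most
      \<open>1 / \<epsilon>^6\<close>, whence 1082.\<close>
    have R_ge: "real (R \<epsilon>) \<ge> 1080 / \<epsilon> ^ 6" and R_le: "real (R \<epsilon>) + 1 \<le> 1082 / \<epsilon> ^ 6"
      using eps_pow[of 6] unfolding R_def by linarith+
    have m_ge: "real (m \<epsilon>) \<ge> 4 / \<epsilon>\<^sup>2" and m_le: "real (m \<epsilon>) \<le> 5 / \<epsilon>\<^sup>2"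
      using eps_pow[of 2] unfolding m_def by linarith+
    have R_pos: "R \<epsilon> > 0"
      using R_ge eps_pow(1)[of 6] by (cases "R \<epsilon>") (auto simp: divide_le_0_iff)
    define err where "err = 1 / (2 * real (R \<epsilon>) * (\<epsilon>\<^sup>2 / 12)\<^sup>2)"
    have err: "err \<le> \<epsilon>\<^sup>2 / 15"
    proof -
      have "1080 \<le> real (R \<epsilon>) * \<epsilon> ^ 6"
        using R_ge eps_pow(1)[of 6] by (simp add: pos_divide_le_eq)
      then show ?thesis
        using \<epsilon>01 R_pos by (simp add: err_def field_simps flip: power_add power_mult)
    qed
    define r where "r = pmf (bind_pmf Q (round_rejects Q (R \<epsilon>) (\<tau> \<epsilon>))) True"
    have r: "0 \<le> r" "r \<le> 1"
      by (simp_all add: r_def pmf_le_1)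
    have accept: "prob_returns Q (A l \<epsilon>) ACCEPT = (1 - r) ^ m \<epsilon>"
      using pmf_verdict_adjacent_tester[OF Q]
      by (simp add: prob_returns_def A_def r_def verdict_pmf_def)
    have "prob_returns Q (A l \<epsilon>) ACCEPT \<ge> 2/3" if "Q \<in> approx_decreasing l (1 / 2 * \<epsilon>)"
    proof -
      have "r \<le> err"
        using reject_prob_close[of Q l "\<epsilon> / 2" "\<epsilon>\<^sup>2 / 12" "R \<epsilon>"] that \<epsilon>01 R_pos
        by (simp add: r_def \<tau>_def err_def)
      then have "real (m \<epsilon>) * r \<le> 5 / \<epsilon>\<^sup>2 * (\<epsilon>\<^sup>2 / 15)"
        using m_le err r eps_pow(1)[of 2] by (intro mult_mono) auto
      also have "\<dots> = 1 / 3"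
        using \<epsilon>01 by simp
      finally have "2 / 3 \<le> 1 + real (m \<epsilon>) * (- r)"
        by simp
      \<comment> \<open>Bernoulli's inequality acts as the union bound over the rounds.\<close>
      also have "\<dots> \<le> (1 + (- r)) ^ m \<epsilon>"
        using r by (intro Bernoulli_inequality) simp
      finally show ?thesis
        by (simp add: accept)
    qed
    moreover have "prob_returns Q (A l \<epsilon>) REJECT \<ge> 2/3"
      if far: "d_TV_set l Q (approx_decreasing l (1 / 2 * \<epsilon>)) \<ge> 4 * \<epsilon>"
    proof -
      have "4 * \<epsilon> \<le> (\<Sum>x\<in>{2..l}. growth_excess Q (\<epsilon> / 2) x) / (\<epsilon> / 2)"
        using far d_TV_set_approx_decreasing_le[OF Q, of "\<epsilon> / 2"] \<epsilon>01 by simp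
      \<comment> \<open>The product of 4 and 1/2 makes the total excess twice
        \<open>\<theta> = \<epsilon>^2\<close>, so that
        \<open>r \<ge> (2 * \<epsilon>^2 - \<epsilon>^2) / 2\<close> below.\<close>
      then have excess: "2 * \<epsilon>\<^sup>2 \<le> (\<Sum>x\<in>{2..l}. growth_excess Q (\<epsilon> / 2) x)"
        using \<epsilon>01 by (simp add: field_simps power2_eq_square)
      have "err \<le> 1 / 2"
        using err eps_pow(2)[of 2] by simp
      then have "r \<ge> ((\<Sum>x\<in>{2..l}. growth_excess Q (\<epsilon> / 2) x) - \<epsilon>\<^sup>2) / 2"
        unfolding r_def \<tau>_def err_def using \<epsilon>01 R_pos by (intro reject_prob_far Q) auto
      then have r_ge: "r \<ge> \<epsilon>\<^sup>2 / 2"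
        using excess by simp
      have "2 = 4 / \<epsilon>\<^sup>2 * (\<epsilon>\<^sup>2 / 2)"
        using \<epsilon>01 by simp
      also have "\<dots> \<le> real (m \<epsilon>) * r"
        using m_ge r_ge by (intro mult_mono) auto
      finally have mr: "2 \<le> real (m \<epsilon>) * r" .
      have "(1 - r) ^ m \<epsilon> \<le> exp (- r) ^ m \<epsilon>"
        using r exp_ge_add_one_self[of "- r"] by (intro power_mono) auto
      also have "\<dots> = exp (- (real (m \<epsilon>) * r))"
        by (simp flip: exp_of_nat_mult)
      also have "\<dots> \<le> exp (- 2)"
        using mr by simp
      also have "\<dots> \<le> 1 / 3"
        using exp_ge_add_one_self[of 2] by (simp add: exp_minus field_simps)
      finally show ?thesis
        by (simp add: prob_returns_REJECT accept)
    qed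
    moreover have "real n \<le> q \<epsilon>" if "(v, n) \<in> set_pmf (run Q (A l \<epsilon>))" for v n
    proof -
      have "real n \<le> real (m \<epsilon>) * (real (R \<epsilon>) + 1)"
        using queries_adjacent_tester[of v n Q] that unfolding A_def
        by (metis of_nat_1 of_nat_add of_nat_le_iff of_nat_mult)
      also have "\<dots> \<le> 5 / \<epsilon>\<^sup>2 * (1082 / \<epsilon> ^ 6)"
        using m_le R_le eps_pow(1) by (intro mult_mono) auto
      also have "\<dots> = 5410 / \<epsilon> ^ 8"
        by (simp flip: power_add)
      also have "\<dots> \<le> q \<epsilon>"
        using eps_pow(1)[of 8] by (simp add: q_def divide_right_mono)
      finally show ?thesis .
    qed
    ultimately show ?thesis
      using only_paircond_adjacent_tester[OF Q] by (auto simp: A_def)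
  qed
  show ?thesis
    by (rule exI[of _ "1/2"], rule exI[of _ 4], rule exI[of _ A], rule exI[of _ q])
      (use q main in simp)
qed

end
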